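(* For every integer $n\ge 1$ there exists a monic polynomial $Q_n$ (with real coefficients) of degree $n-1$ such that for every integer $m\ge 1$, the number $A_{m,n}$ of subdivisions of the point configuration $P_{m,n}$ is $$A_{m,n}=\frac{2^{m-2}}{(n-1)!}\,Q_n(m).$$
   Context: For integers $m,n\ge 1$, the point configuration $P_{m,n}\subset\mathbb R^2$ is the two-row grid consisting of the $n$ bottom points $(0,0),(1,0),\dots,(n-1,0)$ and the $m$ top points $(0,1),(1,1),\dots,(m-1,1)$. A subdivision of a finite point configuration $\mathcal A\subset\mathbb R^2$ is a collection of convex polygons (two-dimensional, with nonempty interior, regarded as convex sets) whose vertices lie in $\mathcal A$, such that the union of the polygons is the convex hull of $\mathcal A$ and each pair of distinct polygons either does not intersect or intersects exactly in a common vertex or a common side. Not all points of $\mathcal A$ need to be vertices of polygons. $A_{m,n}$ denotes the number of subdivisions of $P_{m,n}$, with the convention $A_{1,1}=\tfrac12$ for the degenerate configuration $P_{1,1}$. *)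

theory Defs
  imports "HOL-Analysis.Analysis" "HOL-Computational_Algebra.Polynomial"
begin

definition vertices_of :: "(real \<times> real) set \<Rightarrow> (real \<times> real) set" where
  "vertices_of S = {v. v extreme_point_of S}"

definition convex_polygon :: "(real \<times> real) set \<Rightarrow> bool" where
  "convex_polygon S \<longleftrightarrow> polytope S \<and> interior S \<noteq> {}"

text \<open>The points of \<open>A\<close> need not all be used as vertices. Sides are the one-dimensional
  faces, so a point of \<open>A\<close> in the relative interior of a side does not subdivide that side.\<close>

definition subdivision :: "(real \<times> real) set \<Rightarrow> (real \<times> real) set set \<Rightarrow> bool" where
  "subdivision A \<S> \<longleftrightarrow>
     (\<forall>S\<in>\<S>. convex_polygon S \<and> vertices_of S \<subseteq> A) \<and>
     \<Union>\<S> = convex hull A \<and>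
     (\<forall>S\<in>\<S>. \<forall>T\<in>\<S>. S \<noteq> T \<longrightarrow>
        S \<inter> T = {} \<or>
        (\<exists>v. v \<in> vertices_of S \<and> v \<in> vertices_of T \<and> S \<inter> T = {v}) \<or>
        (\<exists>e. e edge_of S \<and> e edge_of T \<and> S \<inter> T = e))"

definition grid :: "nat \<Rightarrow> nat \<Rightarrow> (real \<times> real) set" where
  "grid m n = (\<lambda>i. (real i, 0)) ` {..<n} \<union> (\<lambda>i. (real i, 1)) ` {..<m}"

text \<open>For \<open>m = n = 1\<close> the configuration is degenerate (it has no subdivision) and the value
  \<open>1/2\<close> is a convention. A subdivision of a finite \<open>A\<close> is a set of convex hulls of subsets
  of \<open>A\<close>, so the cardinality below is always that of a finite set.\<close>

definition num_subdivisions :: "nat \<Rightarrow> nat \<Rightarrow> real" where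
  "num_subdivisions m n =
     (if m = 1 \<and> n = 1 then 1 / 2 else real (card {\<S>. subdivision (grid m n) \<S>}))"

end

theory Submission
  imports Defs
begin

text \<open>
  A subdivision of the two-row grid is determined by the segments joining the two rows that bound
  its polygons. Ordered from left to right, these form a chain from \<open>(0, 0)\<close> to \<open>(p, q)\<close> in
  \<open>{..p} \<times> {..q}\<close>, where \<open>n = p + 1\<close> and \<open>m = q + 1\<close>, and every such chain occurs. Chains
  in a box that contain the bottom satisfy an inclusion-exclusion recurrence with solution
  \<open>2\<^sup>q \<Sum>k. 2\<^bsup>p-k\<^esup> (p choose k) (q choose k)\<close>; outside the degenerate case exactly half of
  them contain the top. For fixed \<open>p\<close> the sum is a polynomial in \<open>q\<close>, and half its value at
  \<open>p = q = 0\<close> agrees with the convention \<open>1/2\<close>.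
\<close>

section \<open>Chains in a finite interval of a poset\<close>

definition chains_between :: "'a::order \<Rightarrow> 'a \<Rightarrow> 'a set set" where
  "chains_between l u =
     {C. C \<subseteq> {l..u} \<and> l \<in> C \<and> u \<in> C \<and> (\<forall>s\<in>C. \<forall>t\<in>C. s \<le> t \<or> t \<le> s)}"

text \<open>Consecutive elements of a chain; for chains of walls, each such pair bounds one
  polygon.\<close>

definition cover_pairs :: "'a::order set \<Rightarrow> ('a \<times> 'a) set" where
  "cover_pairs C = {(s, t). s \<in> C \<and> t \<in> C \<and> s < t \<and> (\<forall>v\<in>C. \<not> (s < v \<and> v < t))}"

lemma chain_successor:
  assumes "finite {l..u}" "C \<in> chains_between l u" "s \<in> C" "s \<noteq> u"
  shows "\<exists>t. (s, t) \<in> cover_pairs C"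
proof -
  have "finite {t\<in>C. s < t}"
    using assms finite_subset[of C "{l..u}"] by (auto simp: chains_between_def)
  moreover have "u \<in> {t\<in>C. s < t}"
    using assms by (auto simp: chains_between_def order_less_le)
  ultimately obtain t where "t \<in> {t\<in>C. s < t}" "\<forall>v\<in>{t\<in>C. s < t}. v \<le> t \<longrightarrow> t = v"
    using finite_has_minimal[of "{t\<in>C. s < t}"] by blast
  thus ?thesis
    using assms by (intro exI[of _ t]) (auto simp: cover_pairs_def order_less_le)
qed

lemma chain_predecessor:
  assumes "finite {l..u}" "C \<in> chains_between l u" "t \<in> C" "t \<noteq> l"
  shows "\<exists>s. (s, t) \<in> cover_pairs C"
proof -
  have "finite {s\<in>C. s < t}"
    using assms finite_subset[of C "{l..u}"] by (auto simp: chains_between_def)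
  moreover have "l \<in> {s\<in>C. s < t}"
    using assms by (auto simp: chains_between_def order_less_le)
  ultimately obtain s where "s \<in> {s\<in>C. s < t}" "\<forall>v\<in>{s\<in>C. s < t}. s \<le> v \<longrightarrow> s = v"
    using finite_has_maximal[of "{s\<in>C. s < t}"] by blast
  thus ?thesis
    using assms by (intro exI[of _ s]) (auto simp: cover_pairs_def order_less_le)
qed

text \<open>Every element of the chain except \<open>u\<close> has a successor, so the first
  components together with \<open>u\<close> give back the chain.\<close>

lemma inj_on_cover_pairs:
  assumes "finite {l..u}"
  shows "inj_on cover_pairs (chains_between l u)"
proof (rule inj_on_inverseI)
  fix C assume C: "C \<in> chains_between l u"
  show "insert u (fst ` cover_pairs C) = C"
  proof
    show "insert u (fst ` cover_pairs C) \<subseteq> C"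
      using C by (auto simp: chains_between_def cover_pairs_def)
    show "C \<subseteq> insert u (fst ` cover_pairs C)"
      using chain_successor[OF assms C] by (metis fst_conv image_eqI insert_iff subsetI)
  qed
qed

text \<open>Nothing in the chain separates the members of a covering pair, so distinct pairs start
  at distinct elements and the earlier one ends before the later one starts. This puts the polygons
  of a chain in left-to-right order.\<close>

lemma cover_pairs_cases:
  assumes "C \<in> chains_between l u" "(s, t) \<in> cover_pairs C" "(s', t') \<in> cover_pairs C"
    "(s, t) \<noteq> (s', t')"
  shows "t \<le> s' \<or> t' \<le> s"
proof -
  have tot: "a \<le> b \<or> b \<le> a" if "a \<in> C" "b \<in> C" for a b
    using assms(1) that by (auto simp: chains_between_def)
  have "s \<noteq> s'"
  proof
    assume "s = s'"
    hence "t < t' \<or> t' < t"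
      using assms tot[of t t'] by (auto simp: cover_pairs_def order_less_le)
    thus False using assms \<open>s = s'\<close> by (auto simp: cover_pairs_def)
  qed
  hence "s < s' \<or> s' < s"
    using assms tot[of s s'] by (auto simp: cover_pairs_def order_less_le)
  thus ?thesis
    using assms tot[of t s'] tot[of t' s] by (auto simp: cover_pairs_def order_less_le)
qed

text \<open>A set of pairs whose \<open>\<phi>\<close>-intervals tile \<open>{0..<\<phi> u}\<close> is totally ordered by \<open>\<phi>\<close>; following
  the tiles from left to right shows that the poset order agrees with this order.\<close>

lemma tiling_cover_pairs:
  fixes \<phi> :: "'a::order \<Rightarrow> nat"
  assumes inj: "inj_on \<phi> {l..u}" and mono: "\<And>s t. s < t \<Longrightarrow> \<phi> s < \<phi> t"
    and zero: "\<phi> l = 0" and lu: "l < u"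
    and R: "\<And>s t. (s, t) \<in> R \<Longrightarrow> l \<le> s \<and> s < t \<and> t \<le> u"
    and covered: "\<And>k. k < \<phi> u \<Longrightarrow> \<exists>s t. (s, t) \<in> R \<and> \<phi> s \<le> k \<and> k < \<phi> t"
    and disj: "\<And>k s t s' t'. \<lbrakk>(s, t) \<in> R; (s', t') \<in> R; \<phi> s \<le> k; k < \<phi> t; \<phi> s' \<le> k; k < \<phi> t'\<rbrakk>
        \<Longrightarrow> s = s' \<and> t = t'"
  shows "\<exists>C\<in>chains_between l u. R = cover_pairs C"
proof -
  define C where "C = insert u (fst ` R)"
  have eqI: "s = t" if "\<phi> s = \<phi> t" "l \<le> s" "s \<le> u" "l \<le> t" "t \<le> u" for s t
    using inj that by (auto simp: inj_on_def)
  have mono': "\<phi> s \<le> \<phi> t" if "s \<le> t" for s t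
    using mono[of s t] that by (cases "s = t") (auto simp: order_less_le)
  have C_sub: "l \<le> s \<and> s \<le> u" if "s \<in> C" for s
    using that R lu unfolding C_def by force
  have C_succ: "\<exists>t. (s, t) \<in> R" if "s \<in> C" "s \<noteq> u" for s
    using that by (force simp: C_def)
  have R_snd: "t \<in> C" if st: "(s, t) \<in> R" for s t
  proof (cases "t = u")
    case False
    hence "t < u" using R[OF st] by (auto simp: order_less_le)
    then obtain s' t' where s't': "(s', t') \<in> R" "\<phi> s' \<le> \<phi> t" "\<phi> t < \<phi> t'"
      using covered[OF mono] by blast
    \<comment> \<open>A tile over position \<open>\<phi> t\<close> that started earlier would also
      contain \<open>\<phi> t - 1\<close>, the last position of the tile
      \<open>(s, t)\<close>.\<close>
    have "\<phi> s' = \<phi> t"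
    proof (rule ccontr)
      assume "\<phi> s' \<noteq> \<phi> t"
      hence "s = s' \<and> t = t'"
        using st s't' mono[of s t] R[OF st]
        by (intro disj[of s t s' t' "\<phi> t - 1"]) auto
      thus False using s't' by auto
    qed
    hence "s' = t" using eqI R[OF st] R[OF s't'(1)] by (meson order.strict_implies_order order_trans)
    thus ?thesis using s't' by (force simp: C_def)
  qed (auto simp: C_def)
  \<comment> \<open>An element of \<open>C\<close> strictly inside the tile \<open>(s, t)\<close>
    would start a second tile at a position already covered.\<close>
  have gap: "\<phi> t \<le> \<phi> v" if st: "(s, t) \<in> R" and v: "v \<in> C" and sv: "\<phi> s < \<phi> v" for s t v
  proof (rule ccontr)
    assume "\<not> \<phi> t \<le> \<phi> v"
    hence lt: "\<phi> v < \<phi> t" by simp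
    hence "v \<noteq> u" using mono'[of t u] R[OF st] by auto
    then obtain w where w: "(v, w) \<in> R" using C_succ v by blast
    have "s = v"
      using disj[OF st w, of "\<phi> v"] sv lt mono[of v w] R[OF w] by auto
    thus False using sv by simp
  qed
  \<comment> \<open>Induction on the distance to \<open>\<phi> u\<close>: move from \<open>s\<close>
    to the end of the tile starting there, which by \<open>gap\<close> does not overshoot
    \<open>t\<close>.\<close>
  have order: "s \<le> t" if "s \<in> C" "t \<in> C" "\<phi> s \<le> \<phi> t" for s t
    using that
  proof (induction "\<phi> u - \<phi> s" arbitrary: s rule: less_induct)
    case less
    show ?case
    proof (cases "\<phi> s = \<phi> t")
      case True
      thus ?thesis using eqI C_sub less.prems by blast
    next
      case False
      have tu: "\<phi> t \<le> \<phi> u" using mono' C_sub less.prems by blast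
      hence "s \<noteq> u" using False less.prems by auto
      then obtain w where w: "(s, w) \<in> R" using C_succ less.prems by blast
      have "\<phi> w \<le> \<phi> t" using gap[OF w] less.prems False by auto
      moreover have "\<phi> s < \<phi> w" using R[OF w] mono by blast
      ultimately have "w \<le> t"
        using less.hyps[of w] less.prems R_snd[OF w] tu by auto
      thus ?thesis using R[OF w] by auto
    qed
  qed
  have "C \<in> chains_between l u"
  proof -
    obtain s t where st: "(s, t) \<in> R" "\<phi> s \<le> 0"
      using covered[of 0] mono[OF lu] by auto
    hence "s = l" using eqI[of s l] R[OF st(1)] zero lu
      by (metis le_zero_eq order.strict_implies_order order_refl order_trans)
    hence "l \<in> C" using st by (force simp: C_def)
    moreover have "u \<in> C" by (simp add: C_def)
    ultimately show ?thesis
      using C_sub order unfolding chains_between_def by (auto, meson nat_le_linear)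
  qed
  moreover have "R = cover_pairs C"
  proof (intro set_eqI iffI; clarify)
    fix s t assume st: "(s, t) \<in> R"
    have "\<not> (s < v \<and> v < t)" if "v \<in> C" for v
      using gap[OF st that] mono[of s v] mono[of v t] by auto
    thus "(s, t) \<in> cover_pairs C"
      using st R[OF st] R_snd[OF st] by (force simp: cover_pairs_def C_def)
  next
    fix s t assume st: "(s, t) \<in> cover_pairs C"
    hence "s \<noteq> u" using C_sub[of t] by (auto simp: cover_pairs_def)
    then obtain w where w: "(s, w) \<in> R" using C_succ st by (auto simp: cover_pairs_def)
    have "w \<le> t" using gap[OF w, of t] st mono[of s t] order R_snd[OF w]
      by (auto simp: cover_pairs_def)
    hence "w = t" using st R[OF w] R_snd[OF w] by (auto simp: cover_pairs_def order_less_le)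
    thus "(s, t) \<in> R" using w by simp
  qed
  ultimately show ?thesis by blast
qed

section \<open>Counting chains in a grid\<close>

text \<open>Only the bottom is required here: a chain that avoids the top then lies in a smaller box
  and belongs to a family of the same kind, which gives a recurrence.\<close>

definition box_chains :: "nat \<Rightarrow> nat \<Rightarrow> (nat \<times> nat) set set" where
  "box_chains p q = {C. C \<subseteq> {..p} \<times> {..q} \<and> (0, 0) \<in> C \<and> (\<forall>s\<in>C. \<forall>t\<in>C. s \<le> t \<or> t \<le> s)}"

lemma finite_box_chains: "finite (box_chains p q)"
  by (rule finite_subset[of _ "Pow ({..p} \<times> {..q})"]) (auto simp: box_chains_def)

text \<open>The top corner is comparable with the whole box, so it can be added or removed freely;
  the hypothesis keeps the removal from deleting \<open>(0, 0)\<close>.\<close>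

lemma bij_betw_box_chains_top:
  assumes "(p, q) \<noteq> (0, 0)"
  shows "bij_betw (insert (p, q)) {C\<in>box_chains p q. (p, q) \<notin> C} {C\<in>box_chains p q. (p, q) \<in> C}"
  using assms
  by (intro bij_betw_byWitness[where f' = "\<lambda>C. C - {(p, q)}"]) (auto simp: box_chains_def)

lemma card_box_chains_double:
  assumes "(p, q) \<noteq> (0, 0)"
  shows "card (box_chains p q) = 2 * card {C\<in>box_chains p q. (p, q) \<notin> C}"
    and "card (box_chains p q) = 2 * card {C\<in>box_chains p q. (p, q) \<in> C}"
proof -
  have "box_chains p q = {C\<in>box_chains p q. (p, q) \<notin> C} \<union> {C\<in>box_chains p q. (p, q) \<in> C}"
    by blast
  hence "card (box_chains p q) =
      card {C\<in>box_chains p q. (p, q) \<notin> C} + card {C\<in>box_chains p q. (p, q) \<in> C}"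
    using finite_box_chains[of p q]
    by (subst card_Un_disjoint[symmetric]) auto
  thus "card (box_chains p q) = 2 * card {C\<in>box_chains p q. (p, q) \<notin> C}"
    and "card (box_chains p q) = 2 * card {C\<in>box_chains p q. (p, q) \<in> C}"
    using bij_betw_same_card[OF bij_betw_box_chains_top[OF assms]] by simp_all
qed

lemma card_box_chains_0_0: "card (box_chains 0 0) = 1"
proof -
  have "box_chains 0 0 = {{(0, 0)}}" by (auto simp: box_chains_def)
  thus ?thesis by simp
qed

lemma card_box_chains_0_Suc: "card (box_chains 0 (Suc q)) = 2 * card (box_chains 0 q)"
proof -
  have "{C\<in>box_chains 0 (Suc q). (0, Suc q) \<notin> C} = box_chains 0 q"
    by (force simp: box_chains_def le_Suc_eq)
  thus ?thesis using card_box_chains_double(1)[of 0 "Suc q"] by simp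
qed

lemma card_box_chains_Suc_0: "card (box_chains (Suc p) 0) = 2 * card (box_chains p 0)"
proof -
  have "{C\<in>box_chains (Suc p) 0. (Suc p, 0) \<notin> C} = box_chains p 0"
    by (force simp: box_chains_def le_Suc_eq)
  thus ?thesis using card_box_chains_double(1)[of "Suc p" 0] by simp
qed

text \<open>A chain avoiding the top corner cannot meet both the last row and the last column.\<close>

lemma card_box_chains_Suc_Suc:
  "card (box_chains (Suc p) (Suc q)) + 2 * card (box_chains p q) =
     2 * (card (box_chains p (Suc q)) + card (box_chains (Suc p) q))"
proof -
  have "{C\<in>box_chains (Suc p) (Suc q). (Suc p, Suc q) \<notin> C} =
      box_chains p (Suc q) \<union> box_chains (Suc p) q" (is "?L = ?R")
  proof
    show "?R \<subseteq> ?L" by (fastforce simp: box_chains_def)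
    show "?L \<subseteq> ?R"
    proof
      fix C assume C: "C \<in> ?L"
      show "C \<in> ?R"
      proof (rule ccontr)
        assume neg: "C \<notin> ?R"
        have sub: "C \<subseteq> {..Suc p} \<times> {..Suc q}" using C by (simp add: box_chains_def)
        have "\<not> C \<subseteq> {..p} \<times> {..Suc q}" "\<not> C \<subseteq> {..Suc p} \<times> {..q}"
          using neg C by (auto simp: box_chains_def)
        then obtain s t where st: "s \<in> C" "s \<notin> {..p} \<times> {..Suc q}" "t \<in> C" "t \<notin> {..Suc p} \<times> {..q}"
          by blast
        have "s \<in> {..Suc p} \<times> {..Suc q}" "t \<in> {..Suc p} \<times> {..Suc q}" "s \<le> t \<or> t \<le> s"
          using st sub C by (auto simp: box_chains_def simp del: mem_Sigma_iff)
        hence "s = (Suc p, Suc q) \<or> t = (Suc p, Suc q)"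
          using st by (cases s; cases t) auto
        thus False using C st by auto
      qed
    qed
  qed
  \<comment> \<open>The overlap of the two families is the correction term of
    inclusion-exclusion.\<close>
  moreover have "box_chains p (Suc q) \<inter> box_chains (Suc p) q = box_chains p q"
    by (auto simp: box_chains_def)
  ultimately show ?thesis
    using card_box_chains_double(1)[of "Suc p" "Suc q"]
      card_Un_Int[OF finite_box_chains[of p "Suc q"] finite_box_chains[of "Suc p" q]]
    by simp
qed

text \<open>The number of box chains with the factor \<open>2 ^ q\<close> divided out, expanded in
  binomials \<open>q choose k\<close> so that it is visibly a polynomial in \<open>q\<close> of
  degree \<open>p\<close>.\<close>

definition chain_weight :: "nat \<Rightarrow> nat \<Rightarrow> real" where
  "chain_weight p q = (\<Sum>k\<le>p. 2 ^ (p - k) * real (p choose k) * real (q choose k))"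

lemma chain_weight_0_left: "chain_weight 0 q = 1"
  by (simp add: chain_weight_def)

lemma chain_weight_0_right: "chain_weight p 0 = 2 ^ p"
proof -
  have "chain_weight p 0 = (\<Sum>k\<in>{0}. 2 ^ (p - k) * real (p choose k) * real (0 choose k))"
    unfolding chain_weight_def by (rule sum.mono_neutral_right) auto
  thus ?thesis by simp
qed

text \<open>This is the recurrence for box chains divided by \<open>2 ^ Suc q\<close>. A difference
  in \<open>q\<close> lowers the index of \<open>q choose Suc k\<close> to \<open>k\<close>, and
  Pascal's rule for \<open>p choose k\<close>, weighted by powers of 2, relates the differences for
  \<open>Suc p\<close> and \<open>p\<close>.\<close>

lemma chain_weight_Suc_Suc:
  "chain_weight (Suc p) (Suc q) =
     2 * chain_weight p (Suc q) + chain_weight (Suc p) q - chain_weight p q"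
proof -
  define a where "a p k = 2 ^ (p - k) * real (p choose k)" for p k :: nat
  \<comment> \<open>The added term vanishes; with it, the shifted sums for \<open>p\<close> and
    \<open>Suc p\<close> have the same index range.\<close>
  have w: "chain_weight p q = (\<Sum>k\<le>Suc p. a p k * real (q choose k))" for p q
    by (simp add: chain_weight_def a_def)
  have a0: "a (Suc p) 0 = 2 * a p 0" by (simp add: a_def)
  have aS: "a (Suc p) (Suc k) = a p k + 2 * a p (Suc k)" for k
  proof (cases "k < p")
    case True
    hence "p - k = Suc (p - Suc k)" by simp
    thus ?thesis by (simp add: a_def algebra_simps)
  qed (auto simp: a_def)
  have w': "chain_weight p q = a p 0 + (\<Sum>k\<le>p. a p (Suc k) * real (q choose Suc k))" for q
    unfolding w by (subst sum.atMost_Suc_shift) simp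
  have w'': "chain_weight (Suc p) q =
      a (Suc p) 0 + (\<Sum>k\<le>p. a (Suc p) (Suc k) * real (q choose Suc k))" for q
    unfolding chain_weight_def a_def by (subst sum.atMost_Suc_shift) simp
  have w0: "chain_weight p q = (\<Sum>k\<le>p. a p k * real (q choose k))"
    by (simp add: chain_weight_def a_def)
  have "chain_weight (Suc p) (Suc q) - chain_weight (Suc p) q =
      (\<Sum>k\<le>p. a (Suc p) (Suc k) * real (q choose k))"
    unfolding w'' by (simp add: sum_subtractf[symmetric] algebra_simps)
  moreover have "chain_weight p (Suc q) - chain_weight p q =
      (\<Sum>k\<le>p. a p (Suc k) * real (q choose k))"
    unfolding w' by (simp add: sum_subtractf[symmetric] algebra_simps)
  moreover have "(\<Sum>k\<le>p. a (Suc p) (Suc k) * real (q choose k)) =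
      chain_weight p q + 2 * (\<Sum>k\<le>p. a p (Suc k) * real (q choose k))"
    unfolding w0 aS by (simp add: sum.distrib algebra_simps sum_distrib_left)
  ultimately show ?thesis by simp
qed

lemma card_box_chains: "real (card (box_chains p q)) = 2 ^ q * chain_weight p q"
proof (induction p arbitrary: q)
  case 0
  show ?case
    by (induction q) (simp_all add: card_box_chains_0_0 card_box_chains_0_Suc chain_weight_0_left)
next
  case (Suc p)
  note IH = Suc
  show ?case
  proof (induction q)
    case 0
    show ?case
      using IH[of 0] by (simp add: card_box_chains_Suc_0 chain_weight_0_right)
  next
    case (Suc q)
    have "real (card (box_chains (Suc p) (Suc q))) + 2 * real (card (box_chains p q)) =
        2 * (real (card (box_chains p (Suc q))) + real (card (box_chains (Suc p) q)))"
      using arg_cong[OF card_box_chains_Suc_Suc[of p q], of real] by simp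
    thus ?case
      unfolding Suc IH by (simp add: chain_weight_Suc_Suc algebra_simps)
  qed
qed

lemma atLeastAtMost_grid: "{(0, 0)..(p, q)} = {..p::nat} \<times> {..q::nat}"
  by auto

lemma card_chains_between_grid:
  assumes "(p, q) \<noteq> (0, 0)"
  shows "real (card (chains_between (0, 0) (p, q))) = 2 ^ q * chain_weight p q / 2"
proof -
  have "chains_between (0, 0) (p, q) = {C\<in>box_chains p q. (p, q) \<in> C}"
    by (auto simp: chains_between_def box_chains_def atLeastAtMost_grid)
  thus ?thesis
    using card_box_chains_double(2)[OF assms] card_box_chains[of p q] by simp
qed

section \<open>Cells between two walls\<close>

text \<open>A pair \<open>s = (a, c)\<close> encodes the segment from \<open>(a, 0)\<close> to \<open>(c, 1)\<close>; \<open>wall s y\<close> is its abscissa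
  at height \<open>y\<close>, and the segment itself is \<open>cell s s\<close>.\<close>

definition wall :: "nat \<times> nat \<Rightarrow> real \<Rightarrow> real" where
  "wall s y = real (fst s) * (1 - y) + real (snd s) * y"

definition cell :: "nat \<times> nat \<Rightarrow> nat \<times> nat \<Rightarrow> (real \<times> real) set" where
  "cell s t = {(x, y). 0 \<le> y \<and> y \<le> 1 \<and> wall s y \<le> x \<and> x \<le> wall t y}"

lemma wall_0 [simp]: "wall s 0 = real (fst s)"
  and wall_1 [simp]: "wall s 1 = real (snd s)"
  by (simp_all add: wall_def)

lemma wall_mono: "s \<le> t \<Longrightarrow> 0 \<le> y \<Longrightarrow> y \<le> 1 \<Longrightarrow> wall s y \<le> wall t y"
  by (auto simp: wall_def less_eq_prod_def intro!: add_mono mult_right_mono)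

lemma wall_strict_mono:
  assumes "s < t" "0 < y" "y < 1"
  shows "wall s y < wall t y"
proof -
  have "(fst s < fst t \<and> snd s \<le> snd t) \<or> (fst s \<le> fst t \<and> snd s < snd t)"
    using assms by (cases s; cases t) (auto simp: less_le_not_le)
  thus ?thesis
    using assms unfolding wall_def
    by (auto intro: add_less_le_mono add_le_less_mono mult_strict_right_mono mult_right_mono)
qed

text \<open>Walls become level sets of a linear functional, which makes half-spaces and supporting
  hyperplanes available.\<close>

lemma inner_wall: "(1, real (fst s) - real (snd s)) \<bullet> (x, y) - real (fst s) = x - wall s y"
  by (simp add: wall_def algebra_simps)

lemma wall_ge_halfspace:
  "{(x, y). wall s y \<le> x} = {z. (1, real (fst s) - real (snd s)) \<bullet> z \<ge> real (fst s)}"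
  by (auto simp: wall_def algebra_simps)

lemma wall_le_halfspace:
  "{(x, y). x \<le> wall s y} = {z. (1, real (fst s) - real (snd s)) \<bullet> z \<le> real (fst s)}"
  by (auto simp: wall_def algebra_simps)

lemma wall_eq_hyperplane:
  "{(x, y). x = wall s y} = {z. (1, real (fst s) - real (snd s)) \<bullet> z = real (fst s)}"
  by (auto simp: wall_def algebra_simps)

lemma convex_cell: "convex (cell s t)"
proof -
  have "cell s t = {z. (0, 1) \<bullet> z \<ge> (0::real)} \<inter> {z. (0, 1) \<bullet> z \<le> (1::real)} \<inter>
      {(x, y). wall s y \<le> x} \<inter> {(x, y). x \<le> wall t y}"
    by (auto simp: cell_def)
  thus ?thesis
    unfolding wall_ge_halfspace wall_le_halfspace
    by (auto intro!: convex_Int convex_halfspace_ge convex_halfspace_le)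
qed

definition two_rows :: "nat set \<Rightarrow> nat set \<Rightarrow> (real \<times> real) set" where
  "two_rows B T = (\<lambda>i. (real i, 0)) ` B \<union> (\<lambda>i. (real i, 1)) ` T"

text \<open>A point of the cell at height \<open>y\<close> is a convex combination of the two outer
  wall points at that height, and each of these is one of the ends of its wall, with weight
  \<open>y\<close> on the upper end.\<close>

lemma convex_hull_two_rows:
  assumes "finite B" "B \<noteq> {}" "finite T" "T \<noteq> {}"
  shows "convex hull (two_rows B T) = cell (Min B, Min T) (Max B, Max T)" (is "?H = cell ?s ?t")
proof
  show "?H \<subseteq> cell ?s ?t"
    using assms by (intro hull_minimal convex_cell) (auto simp: two_rows_def cell_def)
next
  show "cell ?s ?t \<subseteq> ?H"
  proof clarify
    fix x y assume xy: "(x, y) \<in> cell ?s ?t"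
    hence y: "0 \<le> y" "y \<le> 1" and x: "wall ?s y \<le> x" "x \<le> wall ?t y" by (auto simp: cell_def)
    have on_wall: "(wall s y, y) \<in> ?H" if "fst s \<in> B" "snd s \<in> T" for s
    proof -
      have "(1 - y) *\<^sub>R (real (fst s), 0) + y *\<^sub>R (real (snd s), 1) \<in> ?H"
        using that y by (intro convexD_alt convex_convex_hull) (auto simp: two_rows_def intro!: hull_inc)
      thus ?thesis by (simp add: wall_def mult.commute)
    qed
    have H: "(wall ?s y, y) \<in> ?H" "(wall ?t y, y) \<in> ?H"
      using assms by (simp_all add: on_wall)
    show "(x, y) \<in> ?H"
    \<comment> \<open>Where the walls meet, as at the apex of a triangle, the denominator of
      \<open>v\<close> below is zero.\<close>
    proof (cases "wall ?s y = wall ?t y")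
      case True
      thus ?thesis using H x by simp
    next
      case False
      define v where "v = (x - wall ?s y) / (wall ?t y - wall ?s y)"
      have "v * (wall ?t y - wall ?s y) = x - wall ?s y"
        using False by (simp add: v_def)
      hence "x = (1 - v) * wall ?s y + v * wall ?t y"
        by (simp add: algebra_simps)
      moreover have "0 \<le> v" "v \<le> 1"
        using x False by (simp_all add: v_def field_simps)
      ultimately have v: "0 \<le> v" "v \<le> 1" "x = (1 - v) * wall ?s y + v * wall ?t y" by auto
      have "(1 - v) *\<^sub>R (wall ?s y, y) + v *\<^sub>R (wall ?t y, y) \<in> ?H"
        using v H by (intro convexD_alt convex_convex_hull) auto
      moreover have "(1 - v) *\<^sub>R (wall ?s y, y) + v *\<^sub>R (wall ?t y, y) = (x, y)"
        using v by (simp add: algebra_simps)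
      ultimately show ?thesis by simp
    qed
  qed
qed

section \<open>Faces, vertices and interior of a cell\<close>

lemma cell_eq_hull:
  assumes "s \<le> t"
  shows "cell s t = convex hull (two_rows {fst s, fst t} {snd s, snd t})"
  using assms
  by (subst convex_hull_two_rows) (auto simp: less_eq_prod_def min_def max_def prod_eq_iff)

lemma cell_refl_eq_segment: "cell s s = closed_segment (real (fst s), 0) (real (snd s), 1)"
  by (simp add: cell_eq_hull two_rows_def segment_convex_hull insert_commute)

lemma polytope_cell: "s \<le> t \<Longrightarrow> polytope (cell s t)"
  by (simp add: cell_eq_hull polytope_convex_hull two_rows_def)

lemma vertices_of_cell_subset:
  assumes "s \<le> t"
  shows "vertices_of (cell s t) \<subseteq> two_rows {fst s, fst t} {snd s, snd t}"
  unfolding cell_eq_hull[OF assms] vertices_of_def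
  using extreme_point_of_convex_hull by blast

text \<open>The functional of the wall \<open>s\<close> attains its minimum over the cell exactly on
  that wall, so its level set is a supporting hyperplane.\<close>

lemma left_wall_face:
  assumes "s \<le> t"
  shows "cell s s face_of cell s t"
proof -
  let ?h = "(1::real, real (fst s) - real (snd s))"
  have "cell s t \<inter> {z. ?h \<bullet> z = real (fst s)} face_of cell s t"
  proof (rule face_of_Int_supporting_hyperplane_ge[OF convex_cell])
    fix z assume "z \<in> cell s t"
    thus "?h \<bullet> z \<ge> real (fst s)"
      using inner_wall[of s "fst z" "snd z"] by (auto simp: cell_def)
  qed
  moreover have "cell s t \<inter> {z. ?h \<bullet> z = real (fst s)} = cell s s"
    unfolding wall_eq_hyperplane[symmetric] using wall_mono[OF assms] by (force simp: cell_def)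
  ultimately show ?thesis by simp
qed

lemma right_wall_face:
  assumes "s \<le> t"
  shows "cell t t face_of cell s t"
proof -
  let ?h = "(1::real, real (fst t) - real (snd t))"
  have "cell s t \<inter> {z. ?h \<bullet> z = real (fst t)} face_of cell s t"
  proof (rule face_of_Int_supporting_hyperplane_le[OF convex_cell])
    fix z assume "z \<in> cell s t"
    thus "?h \<bullet> z \<le> real (fst t)"
      using inner_wall[of t "fst z" "snd z"] by (auto simp: cell_def)
  qed
  moreover have "cell s t \<inter> {z. ?h \<bullet> z = real (fst t)} = cell t t"
    unfolding wall_eq_hyperplane[symmetric] using wall_mono[OF assms] by (force simp: cell_def)
  ultimately show ?thesis by simp
qed

lemma aff_dim_wall: "aff_dim (cell s s) = 1"
  by (simp add: cell_refl_eq_segment segment_convex_hull aff_dim_convex_hull)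

lemma wall_edges:
  assumes "s \<le> t"
  shows "cell s s edge_of cell s t" "cell t t edge_of cell s t"
  using assms by (simp_all add: edge_of_def aff_dim_wall left_wall_face right_wall_face)

text \<open>Extreme points of a face are extreme points of the whole set.\<close>

lemma wall_ends_vertices:
  assumes "s \<le> t" "r \<in> {s, t}"
  shows "(real (fst r), 0) \<in> vertices_of (cell s t)" "(real (snd r), 1) \<in> vertices_of (cell s t)"
proof -
  have "cell r r face_of cell s t"
    using assms left_wall_face[of s t] right_wall_face[of s t] by (elim insertE) auto
  from extreme_point_of_face[OF this]
  show "(real (fst r), 0) \<in> vertices_of (cell s t)" "(real (snd r), 1) \<in> vertices_of (cell s t)"
    using extreme_point_of_segment[of _ "(real (fst r), 0)" "(real (snd r), 1::real)"]
    by (auto simp: vertices_of_def cell_refl_eq_segment)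
qed

lemma strict_cell_subset_interior:
  "{(x, y). 0 < y \<and> y < 1 \<and> wall s y < x \<and> x < wall t y} \<subseteq> interior (cell s t)"
proof (rule interior_maximal)
  have "open {z. 0 < snd z \<and> snd z < 1 \<and> wall s (snd z) < fst z \<and> fst z < wall t (snd z)}"
    unfolding wall_def
    by (intro open_Collect_conj open_Collect_less continuous_intros)
  thus "open {(x, y). 0 < y \<and> y < 1 \<and> wall s y < x \<and> x < wall t y}"
    by (simp add: case_prod_unfold)
qed (auto simp: cell_def)

lemma convex_polygon_cell:
  assumes "s < t"
  shows "convex_polygon (cell s t)"
proof -
  let ?x = "(wall s (1/2) + wall t (1/2)) / 2"
  have "(?x, 1/2) \<in> {(x, y). 0 < y \<and> y < 1 \<and> wall s y < x \<and> x < wall t y}"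
    using wall_strict_mono[OF assms, of "1/2"] by auto
  hence "(?x, 1/2) \<in> interior (cell s t)" using strict_cell_subset_interior by blast
  thus ?thesis
    using polytope_cell[of s t] assms unfolding convex_polygon_def by auto
qed

text \<open>Heights 0 and 1 cut a cell in intervals whose ends are the coordinates of
  \<open>s\<close> and \<open>t\<close>.\<close>

lemma cell_inject:
  assumes "cell s t = cell s' t'" "s \<le> t" "s' \<le> t'"
  shows "s = s' \<and> t = t'"
proof -
  have "(x, y) \<in> cell s t \<longleftrightarrow> (x, y) \<in> cell s' t'" for x y by (simp add: assms)
  from this[of "real (fst s)" 0] this[of "real (snd s)" 1] this[of "real (fst t)" 0]
    this[of "real (snd t)" 1] this[of "real (fst s')" 0] this[of "real (snd s')" 1]
    this[of "real (fst t')" 0] this[of "real (snd t')" 1]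
  show ?thesis using assms by (auto simp: cell_def less_eq_prod_def prod_eq_iff)
qed

section \<open>Polygons with vertices on the two rows\<close>

lemma interior_empty_of_aff_dim_le_1:
  fixes S :: "(real \<times> real) set"
  assumes "aff_dim S \<le> 1"
  shows "interior S = {}"
  using aff_dim_nonempty_interior[of S] assms by auto

text \<open>A polygon is the hull of its vertices. Having interior points, it cannot have all its
  vertices on one row, nor can its two outer walls coincide.\<close>

lemma polygon_eq_cell:
  assumes "convex_polygon S" "vertices_of S \<subseteq> two_rows {..p} {..q}"
  shows "\<exists>s t. s < t \<and> t \<le> (p, q) \<and> S = cell s t"
proof -
  define B where "B = {i. (real i, 0) \<in> vertices_of S}"
  define T where "T = {i. (real i, 1) \<in> vertices_of S}"
  have V: "vertices_of S = two_rows B T"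
    using assms(2) by (auto simp: B_def T_def two_rows_def)
  have "S = convex hull vertices_of S"
    using assms Krein_Milman_Minkowski[of S]
    by (auto simp: vertices_of_def convex_polygon_def polytope_imp_compact polytope_imp_convex)
  hence S: "S = convex hull (two_rows B T)" by (simp add: V)
  have sub: "B \<subseteq> {..p}" "T \<subseteq> {..q}"
    using assms(2) by (auto simp: B_def T_def two_rows_def)
  hence fin: "finite B" "finite T" using finite_subset by auto
  have int: "interior S \<noteq> {}" using assms by (simp add: convex_polygon_def)
  have row: "interior S = {}" if "two_rows B T \<subseteq> {z. (0, 1) \<bullet> z = c}" for c :: real
  proof -
    have "aff_dim S \<le> aff_dim {z :: real \<times> real. (0, 1) \<bullet> z = c}"
      unfolding S aff_dim_convex_hull using that by (rule aff_dim_subset)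
    thus ?thesis using interior_empty_of_aff_dim_le_1[of S] by (simp add: aff_dim_hyperplane zero_prod_def)
  qed
  have "B \<noteq> {}"
  proof
    assume "B = {}"
    hence "two_rows B T \<subseteq> {z. (0, 1) \<bullet> z = 1}" by (auto simp: two_rows_def)
    thus False using row int by blast
  qed
  moreover have "T \<noteq> {}"
  proof
    assume "T = {}"
    hence "two_rows B T \<subseteq> {z. (0, 1) \<bullet> z = 0}" by (auto simp: two_rows_def)
    thus False using row int by blast
  qed
  ultimately have cell: "S = cell (Min B, Min T) (Max B, Max T)"
    using S convex_hull_two_rows fin by simp
  have le: "(Min B, Min T) \<le> (Max B, Max T)"
    using fin \<open>B \<noteq> {}\<close> \<open>T \<noteq> {}\<close> by auto
  moreover have "(Min B, Min T) \<noteq> (Max B, Max T)"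
    using cell int interior_empty_of_aff_dim_le_1[of S] aff_dim_wall by force
  moreover have "(Max B, Max T) \<le> (p, q)"
    using fin \<open>B \<noteq> {}\<close> \<open>T \<noteq> {}\<close> sub by auto
  ultimately show ?thesis using cell by (auto simp: order_less_le)
qed

section \<open>Subdivisions are chains of walls\<close>

lemma grid_eq_two_rows: "grid (Suc q) (Suc p) = two_rows {..p} {..q}"
  by (simp add: grid_def two_rows_def lessThan_Suc_atMost)

lemma convex_hull_grid: "convex hull (grid (Suc q) (Suc p)) = cell (0, 0) (p, q)"
proof -
  have "Min {..k} = 0" "Max {..k} = k" for k :: nat
    by (auto intro: Min_eqI Max_eqI)
  thus ?thesis unfolding grid_eq_two_rows by (subst convex_hull_two_rows) auto
qed

section \<open>From chains to subdivisions\<close>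

definition cells_of_chain :: "(nat \<times> nat) set \<Rightarrow> (real \<times> real) set set" where
  "cells_of_chain C = (\<lambda>(s, t). cell s t) ` cover_pairs C"

lemma inj_on_cells_of_chain: "inj_on cells_of_chain (chains_between (0, 0) (p, q))"
proof (rule inj_onI)
  fix C D assume CD: "C \<in> chains_between (0, 0) (p, q)" "D \<in> chains_between (0, 0) (p, q)"
    "cells_of_chain C = cells_of_chain D"
  have "inj_on (\<lambda>(s, t). cell s t) (cover_pairs C \<union> cover_pairs D)"
    by (rule inj_onI) (auto simp: cover_pairs_def order_less_le dest!: cell_inject)
  hence "cover_pairs C = cover_pairs D"
    using CD(3) by (auto simp: cells_of_chain_def inj_on_Un_image_eq_iff)
  thus "C = D"
    using CD inj_on_cover_pairs[of "(0::nat, 0::nat)" "(p, q)"]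
    by (auto simp: inj_on_def atLeastAtMost_grid)
qed

text \<open>The cells lie on opposite sides of the walls \<open>t\<close> and \<open>s'\<close>, so
  they meet only where these coincide: along a full wall if \<open>t = s'\<close>, and otherwise at
  most in one end, since strictly ordered walls differ at every height strictly between 0 and
  1.\<close>

lemma cells_meet:
  assumes "s < t" "t \<le> s'" "s' < t'"
  shows "cell s t \<inter> cell s' t' = {} \<or>
     (\<exists>v. v \<in> vertices_of (cell s t) \<and> v \<in> vertices_of (cell s' t') \<and> cell s t \<inter> cell s' t' = {v}) \<or>
     (\<exists>e. e edge_of cell s t \<and> e edge_of cell s' t' \<and> cell s t \<inter> cell s' t' = e)"
proof -
  have le: "s \<le> t" "s' \<le> t'" using assms by auto
  have meet: "cell s t \<inter> cell s' t' = {(x, y). 0 \<le> y \<and> y \<le> 1 \<and> x = wall t y \<and> x = wall s' y}"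
    using wall_mono[OF assms(2)] wall_mono[OF le(1)] wall_mono[OF le(2)]
    by (fastforce simp: cell_def)
  show ?thesis
  proof (cases "t = s'")
    case True
    hence "cell s t \<inter> cell s' t' = cell t t" unfolding meet by (auto simp: cell_def)
    thus ?thesis using wall_edges[OF le(1)] wall_edges[OF le(2)] True by auto
  next
    case False
    hence lt: "t < s'" using assms by auto
    have "cell s t \<inter> cell s' t' =
        (if fst t = fst s' then {(real (fst t), 0)} else {}) \<union>
        (if snd t = snd s' then {(real (snd t), 1)} else {})"
    proof -
      have "y = 0 \<or> y = 1" if "0 \<le> y" "y \<le> 1" "wall t y = wall s' y" for y
        using wall_strict_mono[OF lt, of y] that by force
      thus ?thesis unfolding meet by (fastforce split: if_splits)
    qed
    moreover have "\<not> (fst t = fst s' \<and> snd t = snd s')" using False by (simp add: prod_eq_iff)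
    ultimately show ?thesis
      using wall_ends_vertices[OF le(1), of t] wall_ends_vertices[OF le(2), of s']
      by (auto split: if_splits)
  qed
qed

lemma subdivision_cells_of_chain:
  assumes C: "C \<in> chains_between (0, 0) (p, q)" and pq: "(p, q) \<noteq> (0, 0)"
  shows "subdivision (grid (Suc q) (Suc p)) (cells_of_chain C)"
  unfolding subdivision_def
proof (intro conjI ballI impI)
  have fin: "finite {(0, 0)..(p, q)}" by (simp add: atLeastAtMost_grid)
  have C_le: "v \<le> (p, q)" if "v \<in> C" for v
    using C that by (auto simp: chains_between_def)
  have tot: "a \<le> b \<or> b \<le> a" if "a \<in> C" "b \<in> C" for a b
    using C that by (auto simp: chains_between_def)
  {
    fix S assume "S \<in> cells_of_chain C"
    then obtain s t where st: "S = cell s t" "s \<in> C" "t \<in> C" "s < t"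
      by (auto simp: cells_of_chain_def cover_pairs_def)
    show "convex_polygon S" using st convex_polygon_cell by simp
    have "two_rows {fst s, fst t} {snd s, snd t} \<subseteq> grid (Suc q) (Suc p)"
      using C_le[OF st(2)] C_le[OF st(3)]
      by (auto simp: grid_eq_two_rows two_rows_def less_eq_prod_def)
    thus "vertices_of S \<subseteq> grid (Suc q) (Suc p)"
      using st vertices_of_cell_subset[OF less_imp_le, of s t] by blast
  }
  {
    fix S T assume ST: "S \<in> cells_of_chain C" "T \<in> cells_of_chain C" "S \<noteq> T"
    from ST(1) obtain s t where "S = cell s t" "(s, t) \<in> cover_pairs C"
      by (auto simp: cells_of_chain_def)
    moreover from ST(2) obtain s' t' where "T = cell s' t'" "(s', t') \<in> cover_pairs C"
      by (auto simp: cells_of_chain_def)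
    ultimately have st: "S = cell s t" "(s, t) \<in> cover_pairs C"
      "T = cell s' t'" "(s', t') \<in> cover_pairs C"
      by auto
    hence "s < t" "s' < t'" by (auto simp: cover_pairs_def)
    moreover have "t \<le> s' \<or> t' \<le> s" using cover_pairs_cases[OF C st(2,4)] st ST by auto
    moreover have "cell s' t' \<inter> cell s t = cell s t \<inter> cell s' t'" by blast
    ultimately show "S \<inter> T = {} \<or>
        (\<exists>v. v \<in> vertices_of S \<and> v \<in> vertices_of T \<and> S \<inter> T = {v}) \<or>
        (\<exists>e. e edge_of S \<and> e edge_of T \<and> S \<inter> T = e)"
      using cells_meet[of s t s' t'] cells_meet[of s' t' s t] unfolding st by auto
  }
  show "\<Union> (cells_of_chain C) = convex hull (grid (Suc q) (Suc p))"
    unfolding convex_hull_grid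
  proof (intro equalityI subsetI)
    fix z assume "z \<in> \<Union> (cells_of_chain C)"
    then obtain s t where st: "z \<in> cell s t" "t \<in> C"
      by (auto simp: cells_of_chain_def cover_pairs_def)
    obtain x y where xy: "z = (x, y)" by fastforce
    have y: "0 \<le> y" "y \<le> 1" using st by (auto simp: cell_def xy)
    hence "0 \<le> wall s y" "wall t y \<le> wall (p, q) y"
      using wall_mono[OF C_le[OF st(2)]] by (auto simp: wall_def[of s])
    thus "z \<in> cell (0, 0) (p, q)"
      using st by (simp add: cell_def xy wall_def[of "(0, 0)"])
  next
    fix z assume z: "z \<in> cell (0, 0) (p, q)"
    obtain x y where xy: "z = (x, y)" by fastforce
    have y: "0 \<le> y" "y \<le> 1" "0 \<le> x" "x \<le> wall (p, q) y"
      using z by (auto simp: xy cell_def wall_def[of "(0, 0)"])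
    \<comment> \<open>A minimal element of \<open>?D\<close> is the right wall of a cell containing
      \<open>z\<close>: its predecessor is outside \<open>?D\<close>, hence strictly to the left of
      \<open>z\<close> or the bottom. Excluding the bottom ensures that a predecessor
      exists.\<close>
    let ?D = "{t\<in>C. t \<noteq> (0, 0) \<and> x \<le> wall t y}"
    have "finite ?D" using C fin finite_subset by (fastforce simp: chains_between_def)
    moreover have "(p, q) \<in> ?D" using C pq y by (auto simp: chains_between_def)
    ultimately obtain t where t: "t \<in> ?D" "\<forall>v\<in>?D. v \<le> t \<longrightarrow> t = v"
      using finite_has_minimal[of ?D] by blast
    then obtain s where s: "(s, t) \<in> cover_pairs C"
      using chain_predecessor[OF fin C, of t] by auto
    hence sC: "s \<in> C" "s < t" by (auto simp: cover_pairs_def)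
    hence "s \<notin> ?D" using bspec[OF t(2), of s] by (auto simp only: order_less_le)
    hence "s = (0, 0) \<or> wall s y < x" using sC(1) by auto
    hence "wall s y \<le> x"
    proof
      assume "s = (0, 0)"
      thus ?thesis using y by (simp add: wall_def)
    qed simp
    hence "z \<in> cell s t" using t(1) y by (simp add: cell_def xy)
    thus "z \<in> \<Union> (cells_of_chain C)" using s by (auto simp: cells_of_chain_def)
  qed
qed

text \<open>At height \<open>1 / (q + 2)\<close> distinct walls have distinct abscissae, and multiplying these by
  \<open>q + 2\<close> gives integers; cutting a subdivision at this height produces a tiling.\<close>

definition slice_index :: "nat \<Rightarrow> nat \<times> nat \<Rightarrow> nat" where
  "slice_index q s = fst s * Suc q + snd s"

lemma wall_slice: "wall s (1 / (real q + 2)) = real (slice_index q s) / (real q + 2)"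
proof -
  have *: "1 - 1 / (real q + 2) = (real q + 1) / (real q + 2)"
    by (simp add: field_simps)
  show ?thesis
    unfolding wall_def slice_index_def * by (simp add: add_divide_distrib[symmetric] algebra_simps)
qed

text \<open>The bound \<open>snd s \<le> q\<close> makes \<open>snd s\<close> the last digit of a
  numeral in base \<open>Suc q\<close>, so division with remainder recovers the pair.\<close>

lemma inj_on_slice_index: "inj_on (slice_index q) {(0, 0)..(p, q)}"
proof (rule inj_onI; clarify)
  fix a c a' c' assume *: "(a, c) \<in> {(0, 0)..(p, q)}" "(a', c') \<in> {(0, 0)..(p, q)}"
    "slice_index q (a, c) = slice_index q (a', c')"
  hence "(a * Suc q + c) div Suc q = (a' * Suc q + c') div Suc q"
    "(a * Suc q + c) mod Suc q = (a' * Suc q + c') mod Suc q"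
    by (simp_all only: slice_index_def fst_conv snd_conv)
  thus "a = a' \<and> c = c'" using * by (simp add: div_mult_self3 mod_mult_self3 del: mult_Suc_right)
qed

text \<open>The offset \<open>1/2\<close> keeps the test point off every wall, so the weak
  inequalities of the cell become a half-open condition on integers.\<close>

lemma slice_point_in_cell:
  "((real k + 1/2) / (real q + 2), 1 / (real q + 2)) \<in> cell s t \<longleftrightarrow>
     slice_index q s \<le> k \<and> k < slice_index q t"
proof -
  have "real i / (real q + 2) \<le> (real k + 1/2) / (real q + 2) \<longleftrightarrow> i \<le> k"
    "(real k + 1/2) / (real q + 2) \<le> real i / (real q + 2) \<longleftrightarrow> k < i" for i
    by (auto simp: divide_le_cancel)
  thus ?thesis by (simp add: cell_def wall_slice)
qed

lemma slice_point_in_interior: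
  assumes "slice_index q s \<le> k" "k < slice_index q t"
  shows "((real k + 1/2) / (real q + 2), 1 / (real q + 2)) \<in> interior (cell s t)"
proof -
  have "real (slice_index q s) / (real q + 2) < (real k + 1/2) / (real q + 2)"
    "(real k + 1/2) / (real q + 2) < real (slice_index q t) / (real q + 2)"
    using assms by (auto simp: divide_less_cancel)
  hence "((real k + 1/2) / (real q + 2), 1 / (real q + 2)) \<in>
      {(x, y). 0 < y \<and> y < 1 \<and> wall s y < x \<and> x < wall t y}"
    by (simp add: wall_slice)
  thus ?thesis using strict_cell_subset_interior by blast
qed

text \<open>Every intersection allowed between distinct polygons has dimension at most 1.\<close>

lemma subdivision_interiors_disjoint:
  assumes "subdivision A \<S>" "S \<in> \<S>" "T \<in> \<S>" "z \<in> interior S" "z \<in> interior T"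
  shows "S = T"
proof (rule ccontr)
  assume "S \<noteq> T"
  hence "S \<inter> T = {} \<or>
      (\<exists>v. v \<in> vertices_of S \<and> v \<in> vertices_of T \<and> S \<inter> T = {v}) \<or>
      (\<exists>e. e edge_of S \<and> e edge_of T \<and> S \<inter> T = e)"
    using assms(1-3) by (simp add: subdivision_def)
  hence "aff_dim (S \<inter> T) \<le> 1"
    by (elim disjE exE conjE) (simp_all add: edge_of_def)
  thus False using interior_empty_of_aff_dim_le_1[of "S \<inter> T"] assms(4,5) by auto
qed

text \<open>All polygons are cells. Testing the points of the slice turns covering and disjointness
  of interiors into a tiling by integer intervals, and \<open>tiling_cover_pairs\<close> supplies
  the chain.\<close>

lemma subdivision_eq_cells_of_chain:
  assumes sub: "subdivision (grid (Suc q) (Suc p)) \<S>" and pq: "(p, q) \<noteq> (0, 0)"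
  shows "\<exists>C\<in>chains_between (0, 0) (p, q). \<S> = cells_of_chain C"
proof -
  define R where "R = {(s, t). s < t \<and> t \<le> (p, q) \<and> cell s t \<in> \<S>}"
  have cells: "\<exists>s t. (s, t) \<in> R \<and> S = cell s t" if "S \<in> \<S>" for S
  proof -
    have "convex_polygon S" "vertices_of S \<subseteq> two_rows {..p} {..q}"
      using sub that by (simp_all add: subdivision_def grid_eq_two_rows)
    from polygon_eq_cell[OF this] show ?thesis using that by (auto simp: R_def)
  qed
  have R: "\<S> = (\<lambda>(s, t). cell s t) ` R"
  proof (intro equalityI subsetI)
    fix S assume "S \<in> \<S>"
    then obtain s t where "(s, t) \<in> R" "S = cell s t" using cells by blast
    thus "S \<in> (\<lambda>(s, t). cell s t) ` R" by (intro image_eqI[of _ _ "(s, t)"]) simp_all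
  qed (auto simp: R_def)
  have "\<exists>C\<in>chains_between (0, 0) (p, q). R = cover_pairs C"
  proof (rule tiling_cover_pairs[of "slice_index q"])
    show "inj_on (slice_index q) {(0, 0)..(p, q)}" by (rule inj_on_slice_index)
    show "slice_index q s < slice_index q t" if "s < t" for s t
    proof -
      have "wall s (1 / (real q + 2)) < wall t (1 / (real q + 2))"
        using that by (intro wall_strict_mono) auto
      thus ?thesis by (simp add: wall_slice divide_less_cancel)
    qed
    show "slice_index q (0, 0) = 0" by (simp add: slice_index_def)
    show "(0, 0) < (p, q)" using pq unfolding less_le_not_le by auto
    show "(0, 0) \<le> s \<and> s < t \<and> t \<le> (p, q)" if "(s, t) \<in> R" for s t
      using that by (simp add: R_def less_eq_prod_def)
    show "\<exists>s t. (s, t) \<in> R \<and> slice_index q s \<le> k \<and> k < slice_index q t"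
      if "k < slice_index q (p, q)" for k
    proof -
      have "((real k + 1/2) / (real q + 2), 1 / (real q + 2)) \<in> cell (0, 0) (p, q)"
        using that by (simp add: slice_point_in_cell slice_index_def)
      also have "cell (0, 0) (p, q) = \<Union>\<S>"
        using sub by (simp add: subdivision_def convex_hull_grid)
      finally obtain S where "S \<in> \<S>"
        "((real k + 1/2) / (real q + 2), 1 / (real q + 2)) \<in> S" by blast
      thus ?thesis using cells[of S] slice_point_in_cell[of k q] by blast
    qed
    show "s = s' \<and> t = t'"
      if "(s, t) \<in> R" "(s', t') \<in> R" "slice_index q s \<le> k" "k < slice_index q t"
        "slice_index q s' \<le> k" "k < slice_index q t'" for k s t s' t'
    proof (rule cell_inject)
      show "cell s t = cell s' t'"
        using that
        by (intro subdivision_interiors_disjoint[OF sub _ _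
              slice_point_in_interior[of q s k t] slice_point_in_interior[of q s' k t']])
          (simp_all add: R_def)
    qed (use that in \<open>auto simp: R_def\<close>)
  qed
  thus ?thesis using R by (auto simp: cells_of_chain_def)
qed

lemma card_subdivisions:
  assumes "(p, q) \<noteq> (0, 0)"
  shows "card {\<S>. subdivision (grid (Suc q) (Suc p)) \<S>} = card (chains_between (0, 0) (p, q))"
proof -
  have "{\<S>. subdivision (grid (Suc q) (Suc p)) \<S>} =
      cells_of_chain ` chains_between (0, 0) (p, q)"
    using subdivision_cells_of_chain subdivision_eq_cells_of_chain assms by blast
  thus ?thesis by (simp add: card_image inj_on_cells_of_chain)
qed

lemma num_subdivisions_eq:
  "num_subdivisions (Suc q) (Suc p) = 2 ^ q * chain_weight p q / 2"
proof (cases "(p, q) = (0, 0)")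
  case True
  thus ?thesis by (simp add: num_subdivisions_def chain_weight_0_left)
next
  case False
  thus ?thesis
    using card_subdivisions[OF False] card_chains_between_grid[OF False]
    by (auto simp: num_subdivisions_def)
qed

section \<open>The polynomial\<close>

text \<open>The falling factorial \<open>(x - 1) (x - 2) ... (x - k)\<close>, shifted by one because
  the variable is \<open>m = q + 1\<close>.\<close>

definition falling_poly :: "nat \<Rightarrow> real poly" where
  "falling_poly k = (\<Prod>i<k. [:- 1 - real i, 1:])"

lemma lead_coeff_falling_poly: "lead_coeff (falling_poly k) = 1"
  by (simp add: falling_poly_def lead_coeff_prod)

lemma degree_falling_poly: "degree (falling_poly k) = k"
  by (simp add: falling_poly_def degree_prod_eq_sum_degree)

lemma poly_falling_poly: "poly (falling_poly k) (real (Suc q)) = fact k * real (q choose k)"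
  by (simp add: falling_poly_def poly_prod binomial_gbinomial gbinomial_prod_rev
      atLeast0LessThan)

theorem theorem2:
  fixes n :: nat
  assumes "n \<ge> 1"
  shows "\<exists>Q :: real poly. lead_coeff Q = 1 \<and> degree Q = n - 1 \<and>
    (\<forall>m::nat. m \<ge> 1 \<longrightarrow>
       num_subdivisions m n = 2 powi (int m - 2) / fact (n - 1) * poly Q (real m))"
proof -
  obtain p where n: "n = Suc p" using assms by (cases n) auto
  \<comment> \<open>Chosen so that \<open>Q\<close> at \<open>Suc q\<close> is
    \<open>fact p * chain_weight p q\<close>, with \<open>falling_poly k\<close> divided by
    \<open>fact k\<close> standing for \<open>q choose k\<close>.\<close>
  define c :: "nat \<Rightarrow> real" where "c k = fact p / fact k * 2 ^ (p - k) * real (p choose k)" for k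
  define Q where "Q = (\<Sum>k\<le>p. smult (c k) (falling_poly k))"
  have "degree Q \<le> p"
    unfolding Q_def by (rule degree_sum_le) (auto simp: degree_falling_poly)
  \<comment> \<open>Only the summand \<open>k = p\<close> reaches degree \<open>p\<close>, and
    \<open>c p = 1\<close>.\<close>
  moreover have coeff: "coeff Q p = 1"
  proof -
    have "(\<Sum>k<p. coeff (smult (c k) (falling_poly k)) p) = 0"
      by (rule sum.neutral) (simp add: coeff_eq_0 degree_falling_poly)
    moreover have "coeff (smult (c p) (falling_poly p)) p = 1"
      using lead_coeff_falling_poly[of p] by (simp add: degree_falling_poly c_def)
    ultimately show ?thesis
      by (simp add: Q_def coeff_sum sum.lessThan_Suc[of _ p, unfolded lessThan_Suc_atMost])
  qed
  ultimately have deg: "degree Q = p" by (simp add: le_antisym le_degree)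
  have "num_subdivisions m n = 2 powi (int m - 2) / fact (n - 1) * poly Q (real m)"
    if "m \<ge> 1" for m
  proof -
    obtain q where m: "m = Suc q" using \<open>m \<ge> 1\<close> by (cases m) auto
    have Q_m: "poly Q (real m) = fact p * chain_weight p q"
      unfolding Q_def m chain_weight_def poly_sum poly_smult poly_falling_poly
      by (simp add: c_def sum_distrib_left mult_ac)
    \<comment> \<open>The power is an integer one because the exponent is -1 at
      \<open>m = 1\<close>.\<close>
    have pow: "2 powi (int m - 2) = (2 ^ q / 2 :: real)"
      by (simp add: m power_int_diff)
    show ?thesis
      using num_subdivisions_eq[of q p] unfolding Q_m pow by (simp add: n m)
  qed
  thus ?thesis using deg coeff n by auto
qed

end
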